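(* Let $1<s,p<\infty$, $n\ge2$, let $\Omega\subseteq\mathbb{R}^n$ be a domain, let $a=(a_1,\dots,a_n)$ be a weight vector as in the context, and put $m=\min\{s,2\}$ and $M=\max\{s,2\}$. Then there exist constants $0<c\le C<\infty$ depending only on $p$ and $s$ such that for almost all $x\in\Omega$, all $\xi,\eta\in\mathbb{R}^n$ with $|\xi|_{s,a}\le|\eta|_{s,a}$, and all $l\in[m,M]$, $$c\,|\eta|_{s,a}^{l}\left(|\eta|_{s,a}+|\xi|_{s,a}\right)^{p-l}\le D_{|\cdot|_{s,a}^{p}}(\xi+\eta,\xi)\le C\,|\eta|_{s,a}^{l}\left(|\eta|_{s,a}+|\xi|_{s,a}\right)^{p-l}.$$
   Context: The functions $a_1,\dots,a_n:\Omega\to(0,\infty)$ are Lebesgue measurable and locally equivalent to $1$: for every domain $\omega$ whose closure is a compact subset of $\Omega$ there are constants $0<c_\omega\le C_\omega<\infty$ with $c_\omega\le a_i\le C_\omega$ a.e. in $\omega$. For almost all $x\in\Omega$ and $\xi\in\mathbb{R}^n$, $|\xi|_{s,a}=\left(\sum_{i=1}^n a_i(x)|\xi_i|^s\right)^{1/s}$. The Bregman distance of $|\cdot|_{s,a}^p$ is $$D_{|\cdot|_{s,a}^{p}}(\xi+\eta,\xi)=|\xi+\eta|_{s,a}^{p}-|\xi|_{s,a}^{p}-p|\xi|_{s,a}^{p-s}\sum_{i=1}^{n}a_{i}(x)|\xi_{i}|^{s-2}\xi_{i}\eta_{i},$$ where the last term is $0$ if $\xi=0$ and $|t|^{s-2}t=0$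 for $t=0$. Expressions $|\eta|_{s,a}^{l}(|\eta|_{s,a}+|\xi|_{s,a})^{p-l}$ are understood as $0$ when $\xi=\eta=0$. *)

theory Defs
  imports "HOL-Analysis.Analysis"
begin

text \<open>
  The constants in the estimate do not depend on the dimension, so \<open>n\<close> has to be quantified
  inside the formula and cannot be the cardinality of a type. The space \<open>\<real>\<^sup>n\<close> is therefore the set of
  functions \<open>nat \<Rightarrow> real\<close> with coordinates indexed by \<open>{1..n}\<close> (extensional outside this set),
  which is the carrier of both the product topology and the product measure below.
\<close>

abbreviation Rn :: "nat \<Rightarrow> (nat \<Rightarrow> real) set" where
  "Rn n \<equiv> {1..n} \<rightarrow>\<^sub>E UNIV"

abbreviation Rn_top :: "nat \<Rightarrow> (nat \<Rightarrow> real) topology" where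
  "Rn_top n \<equiv> product_topology (\<lambda>_. euclideanreal) {1..n}"

abbreviation Rn_lebesgue :: "nat \<Rightarrow> (nat \<Rightarrow> real) measure" where
  "Rn_lebesgue n \<equiv> completion (Pi\<^sub>M {1..n} (\<lambda>_. lborel))"

definition Rn_add :: "nat \<Rightarrow> (nat \<Rightarrow> real) \<Rightarrow> (nat \<Rightarrow> real) \<Rightarrow> nat \<Rightarrow> real" where
  "Rn_add n \<xi> \<eta> = (\<lambda>i\<in>{1..n}. \<xi> i + \<eta> i)"

definition is_domain :: "nat \<Rightarrow> (nat \<Rightarrow> real) set \<Rightarrow> bool" where
  "is_domain n \<Omega> \<longleftrightarrow> \<Omega> \<noteq> {} \<and> openin (Rn_top n) \<Omega> \<and> connectedin (Rn_top n) \<Omega>"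

text \<open>In the following, \<open>a i x\<close> is \<open>a\<^sub>i(x)\<close>; only \<open>i \<in> {1..n}\<close> and \<open>x \<in> \<Omega>\<close> matter.\<close>

definition loc_equiv_one ::
    "nat \<Rightarrow> (nat \<Rightarrow> real) set \<Rightarrow> (nat \<Rightarrow> (nat \<Rightarrow> real) \<Rightarrow> real) \<Rightarrow> bool" where
  "loc_equiv_one n \<Omega> a \<longleftrightarrow>
    (\<forall>\<omega>. is_domain n \<omega> \<and> compactin (Rn_top n) (Rn_top n closure_of \<omega>)
         \<and> Rn_top n closure_of \<omega> \<subseteq> \<Omega> \<longrightarrow>
      (\<exists>c C :: real. 0 < c \<and> c \<le> C \<and>
        (\<forall>i\<in>{1..n}. AE x in Rn_lebesgue n. x \<in> \<omega> \<longrightarrow> c \<le> a i x \<and> a i x \<le> C)))"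

definition weight_vector ::
    "nat \<Rightarrow> (nat \<Rightarrow> real) set \<Rightarrow> (nat \<Rightarrow> (nat \<Rightarrow> real) \<Rightarrow> real) \<Rightarrow> bool" where
  "weight_vector n \<Omega> a \<longleftrightarrow>
    (\<forall>i\<in>{1..n}. a i \<in> borel_measurable (restrict_space (Rn_lebesgue n) \<Omega>)
                 \<and> (\<forall>x\<in>\<Omega>. 0 < a i x))
    \<and> loc_equiv_one n \<Omega> a"

text \<open>The norm at a fixed point \<open>x\<close>; the argument \<open>w\<close> stands for \<open>(a\<^sub>1(x), \<dots>, a\<^sub>n(x))\<close>.\<close>

definition wnorm :: "nat \<Rightarrow> real \<Rightarrow> (nat \<Rightarrow> real) \<Rightarrow> (nat \<Rightarrow> real) \<Rightarrow> real" where
  "wnorm n s w \<xi> = (\<Sum>i=1..n. w i * \<bar>\<xi> i\<bar> powr s) powr (1 / s)"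

text \<open>
  Since \<open>0 powr r = 0\<close> for every \<open>r\<close>, the product \<open>\<bar>t\<bar>\<^sup>s\<^sup>-\<^sup>2 t\<close> is \<open>0\<close> for \<open>t = 0\<close>, and
  the last term below is \<open>0\<close> for \<open>\<xi> = 0\<close>, also when \<open>s < 2\<close> or \<open>p < s\<close>.
\<close>

definition bregman ::
    "nat \<Rightarrow> real \<Rightarrow> real \<Rightarrow> (nat \<Rightarrow> real) \<Rightarrow> (nat \<Rightarrow> real) \<Rightarrow> (nat \<Rightarrow> real) \<Rightarrow> real" where
  "bregman n s p w \<zeta> \<xi> =
     wnorm n s w \<zeta> powr p - wnorm n s w \<xi> powr p
     - p * wnorm n s w \<xi> powr (p - s)
         * (\<Sum>i=1..n. w i * \<bar>\<xi> i\<bar> powr (s - 2) * \<xi> i * (\<zeta> i - \<xi> i))"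

end

theory Submission imports Defs begin

text \<open>
  Since \<open>|\<xi>| \<le> |\<eta>|\<close>, all the expressions \<open>|\<eta>|\<^sup>l (|\<eta>| + |\<xi>|)\<^sup>p\<^sup>-\<^sup>l\<close> are comparable to \<open>|\<eta>|\<^sup>p\<close>, so it
  suffices to compare the Bregman distance with \<open>|\<eta>|\<^sup>p\<close>. The upper bound follows from the Hoelder
  and Minkowski inequalities. For the lower bound, write the distance as the sum of the
  one-dimensional Bregman distance of \<open>|\<xi> + \<eta>|\<close> and \<open>|\<xi>|\<close> and of a multiple of the defect in the
  Hoelder inequality; both are nonnegative. If \<open>|\<xi> + \<eta>|\<close> and \<open>|\<xi>|\<close> differ by at least
  \<open>\<epsilon>|\<eta>|\<close>, the first summand is large. Otherwise \<open>|\<xi>|\<close> is comparable to \<open>|\<eta>|\<close>, and the second summand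
  is large by the case \<open>p = s\<close>, in which the distance is a sum over the coordinates and a
  one-dimensional compactness argument applies.
\<close>

section \<open>One-dimensional Bregman distance of a power function\<close>

definition power_bregman :: "real \<Rightarrow> real \<Rightarrow> real \<Rightarrow> real" where
  "power_bregman r z x =
     \<bar>z\<bar> powr r - \<bar>x\<bar> powr r - r * (\<bar>x\<bar> powr (r - 2) * x) * (z - x)"

lemma abs_powr_diff_2_mult_self:
  fixes x r :: real
  shows "\<bar>x\<bar> powr (r - 2) * x * x = \<bar>x\<bar> powr r"
proof (cases "x = 0")
  case False
  then show ?thesis
    using powr_add[of "\<bar>x\<bar>" "r - 2" 2] by (simp add: power2_eq_square mult.assoc)
qed simp

lemma powr_diff_2_mult_nonneg:
  fixes x r :: real
  assumes "0 \<le> x"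
  shows "x powr (r - 2) * x = x powr (r - 1)"
proof (cases "x = 0")
  case False
  then show ?thesis
    using assms powr_add[of x "r - 2" 1] by simp
qed simp

text \<open>In this form nonnegativity is Young's inequality for
  \<open>\<bar>x\<bar> powr (r - 2) * x\<close> and \<open>z\<close>; only the last term mixes the
  arguments, which suits sums over coordinates.\<close>

lemma power_bregman_altdef:
  "power_bregman r z x =
     \<bar>z\<bar> powr r + (r - 1) * \<bar>x\<bar> powr r - r * (\<bar>x\<bar> powr (r - 2) * x * z)"
  unfolding power_bregman_def
  by (simp flip: abs_powr_diff_2_mult_self[of x r] add: algebra_simps)

lemma power_bregman_scale:
  "power_bregman r (k * z) (k * x) = \<bar>k\<bar> powr r * power_bregman r z x"
proof -
  have *: "\<bar>k * x\<bar> powr (r - 2) * (k * x) * (k * z) =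
      \<bar>k\<bar> powr r * (\<bar>x\<bar> powr (r - 2) * x * z)"
    by (simp flip: abs_powr_diff_2_mult_self[of k r] add: abs_mult powr_mult mult_ac)
  show ?thesis
    unfolding power_bregman_altdef *
    by (simp add: abs_mult powr_mult algebra_simps)
qed

text \<open>Mean value theorem between \<open>t\<close> and 1: the derivative
  \<open>r * u powr (r - 1)\<close> is less than \<open>r\<close> for \<open>u < 1\<close> and
  greater for \<open>u > 1\<close>.\<close>

lemma Bernoulli_powr_strict:
  fixes t r :: real
  assumes "1 < r" "0 < t" "t \<noteq> 1"
  shows "1 + r * (t - 1) < t powr r"
proof -
  have der: "((\<lambda>u. u powr r) has_real_derivative r * u powr (r - 1)) (at u)" if "u > 0" for u
    using that by (auto intro!: derivative_eq_intros)
  show ?thesis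
  proof (cases "t < 1")
    case True
    obtain u where u: "t < u" "u < 1" "1 powr r - t powr r = (1 - t) * (r * u powr (r - 1))"
      using MVT2[OF True, of "\<lambda>u. u powr r" "\<lambda>u. r * u powr (r - 1)"] der assms by auto
    have "u powr (r - 1) < 1 powr (r - 1)"
      using u assms by (intro powr_less_mono2) auto
    then have "(1 - t) * (r * u powr (r - 1)) < (1 - t) * (r * 1)"
      using True assms by (intro mult_strict_left_mono) auto
    with u show ?thesis by (simp add: algebra_simps)
  next
    case False
    then have t: "1 < t" using assms by simp
    obtain u where u: "1 < u" "u < t" "t powr r - 1 powr r = (t - 1) * (r * u powr (r - 1))"
      using MVT2[OF t, of "\<lambda>u. u powr r" "\<lambda>u. r * u powr (r - 1)"] der assms by auto
    have "1 < u powr (r - 1)"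
      using u assms by simp
    then have "(t - 1) * (r * 1) < (t - 1) * (r * u powr (r - 1))"
      using t assms by (intro mult_strict_left_mono) auto
    with u show ?thesis by (simp add: algebra_simps)
  qed
qed

text \<open>Homogeneity moves a nonzero base point to 1. There Bernoulli covers
  \<open>t > 0\<close>, and for \<open>t \<le> 0\<close> the mixed term has a favourable
  sign.\<close>

lemma power_bregman_pos:
  assumes "1 < r" "z \<noteq> x"
  shows "0 < power_bregman r z x"
proof (cases "x = 0")
  case True
  then show ?thesis using assms by (simp add: power_bregman_def)
next
  case False
  define t where "t = z / x"
  have "t \<noteq> 1" using assms False by (simp add: t_def)
  have "0 < power_bregman r t 1"
  proof (cases "t \<le> 0")
    case True
    then have "r * t \<le> 0" using assms by (simp add: mult_nonneg_nonpos)
    then have "r * t < \<bar>t\<bar> powr r + (r - 1)"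
      using assms by (intro order.strict_trans1[OF _ add_nonneg_pos]) auto
    then show ?thesis by (simp add: power_bregman_altdef)
  next
    case False
    then show ?thesis
      using Bernoulli_powr_strict[of r t] assms \<open>t \<noteq> 1\<close>
      by (simp add: power_bregman_def)
  qed
  then have "0 < power_bregman r (x * t) (x * 1)"
    unfolding power_bregman_scale using False by simp
  then show ?thesis using False by (simp add: t_def)
qed

lemma power_bregman_nonneg:
  assumes "1 < r"
  shows "0 \<le> power_bregman r z x"
  using power_bregman_pos[OF assms, of z x]
  by (cases "z = x") (auto simp: power_bregman_def)

lemma power_bregman_lower:
  assumes r: "1 < r"
  obtains c where "0 < c" "\<And>x h. \<bar>x\<bar> \<le> K * \<bar>h\<bar> \<Longrightarrow> c * \<bar>h\<bar> powr r \<le> power_bregman r (x + h) x"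
proof -
  \<comment> \<open>by homogeneity it suffices to treat \<open>h = 1\<close>, where \<open>x\<close> ranges over a compact interval\<close>
  have odd_power: "\<bar>u\<bar> powr (r - 2) * u = max u 0 powr (r - 1) - max (- u) 0 powr (r - 1)" for u :: real
    using powr_diff_2_mult_nonneg[of "\<bar>u\<bar>" r] by (cases "0 \<le> u") (auto simp: max_def)
  \<comment> \<open>The exponent \<open>r - 2\<close> may be negative. After rewriting by
    \<open>odd_power\<close> the bases are nonnegative and the exponent \<open>r - 1\<close> is
    positive, so continuity holds at 0 as well.\<close>
  have "continuous_on {- K..K} (\<lambda>u. power_bregman r (u + 1) u)"
    unfolding power_bregman_def odd_power using r
    by (intro continuous_intros continuous_on_powr') auto
  then have attains: "\<exists>u\<in>{- K..K}. \<forall>v\<in>{- K..K}.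
      power_bregman r (u + 1) u \<le> power_bregman r (v + 1) v" if "{- K..K} \<noteq> {}"
    using that by (intro continuous_attains_inf) auto
  have "\<exists>c>0. \<forall>v\<in>{- K..K}. c \<le> power_bregman r (v + 1) v"
  proof (cases "{- K..K} = {}")
    \<comment> \<open>Here \<open>K < 0\<close>, and any positive constant serves.\<close>
    case True
    show ?thesis unfolding True by (auto intro: exI[of _ 1])
  next
    case False
    then obtain u where "\<forall>v\<in>{- K..K}. power_bregman r (u + 1) u \<le> power_bregman r (v + 1) v"
      using attains by blast
    moreover have "0 < power_bregman r (u + 1) u" by (intro power_bregman_pos[OF r]) simp
    ultimately show ?thesis by blast
  qed
  then obtain c where c: "0 < c" "\<And>v. v \<in> {- K..K} \<Longrightarrow> c \<le> power_bregman r (v + 1) v"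
    by blast
  show ?thesis
  proof (rule that[OF c(1)])
    fix x h :: real
    assume le: "\<bar>x\<bar> \<le> K * \<bar>h\<bar>"
    show "c * \<bar>h\<bar> powr r \<le> power_bregman r (x + h) x"
    proof (cases "h = 0")
      case True
      then show ?thesis using power_bregman_nonneg[OF r] by simp
    next
      case False
      have "\<bar>x / h\<bar> \<le> K" using le False by (simp add: field_simps)
      then have "c \<le> power_bregman r (x / h + 1) (x / h)"
        by (intro c(2)) (unfold atLeastAtMost_iff, linarith)
      then have "\<bar>h\<bar> powr r * c \<le> power_bregman r (h * (x / h + 1)) (h * (x / h))"
        unfolding power_bregman_scale by (intro mult_left_mono) auto
      then show ?thesis using False by (simp add: algebra_simps)
    qed
  qed
qed

text \<open>Adding the distance with exchanged arguments leaves \<open>r\<close> times the increment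
  of \<open>u powr (r - 1)\<close> times \<open>z - x\<close>, and that increment is at most
  \<open>R powr (r - 1)\<close>. The bound makes the radial part small when two norms are
  close.\<close>

lemma power_bregman_upper:
  assumes r: "1 < r" and "0 \<le> x" "0 \<le> z" "x \<le> R" "z \<le> R"
  shows "power_bregman r z x \<le> r * R powr (r - 1) * \<bar>z - x\<bar>"
proof -
  have eq: "power_bregman r v u = v powr r - u powr r - r * u powr (r - 1) * (v - u)"
    if "0 \<le> u" "0 \<le> v" for u v
    using that by (simp add: power_bregman_def powr_diff_2_mult_nonneg)
  have "power_bregman r z x \<le> power_bregman r z x + power_bregman r x z"
    using power_bregman_nonneg[OF r] by simp
  also have "\<dots> = r * ((z powr (r - 1) - x powr (r - 1)) * (z - x))"
    using assms by (simp add: eq algebra_simps)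
  also have "\<dots> \<le> r * (R powr (r - 1) * \<bar>z - x\<bar>)"
  proof (intro mult_left_mono)
    have "z powr (r - 1) \<le> R powr (r - 1)" "x powr (r - 1) \<le> R powr (r - 1)"
      using assms by (auto intro!: powr_mono2)
    then have "\<bar>z powr (r - 1) - x powr (r - 1)\<bar> \<le> R powr (r - 1)"
      by (smt (verit) powr_ge_zero)
    then have "\<bar>z powr (r - 1) - x powr (r - 1)\<bar> * \<bar>z - x\<bar> \<le> R powr (r - 1) * \<bar>z - x\<bar>"
      by (intro mult_right_mono) auto
    then show "(z powr (r - 1) - x powr (r - 1)) * (z - x) \<le> R powr (r - 1) * \<bar>z - x\<bar>"
      by (simp flip: abs_mult)
  qed (use r in auto)
  finally show ?thesis by (simp add: mult.assoc)
qed

section \<open>Weighted norm and pairing: Hoelder, Minkowski, decomposition\<close>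

text \<open>This is the derivative of the \<open>s\<close>-th power of the norm, divided by
  \<open>s\<close>, at \<xi> in direction \<eta>.\<close>

definition duality_pairing ::
    "nat \<Rightarrow> real \<Rightarrow> (nat \<Rightarrow> real) \<Rightarrow> (nat \<Rightarrow> real) \<Rightarrow> (nat \<Rightarrow> real) \<Rightarrow> real" where
  "duality_pairing n s w \<xi> \<eta> = (\<Sum>i=1..n. w i * \<bar>\<xi> i\<bar> powr (s - 2) * \<xi> i * \<eta> i)"

lemma wnorm_nonneg [simp]: "0 \<le> wnorm n s w \<xi>"
  by (simp add: wnorm_def)

lemma wnorm_uminus [simp]: "wnorm n s w (\<lambda>i. - \<xi> i) = wnorm n s w \<xi>"
  by (simp add: wnorm_def)

lemma duality_pairing_add:
  "duality_pairing n s w \<xi> (\<lambda>i. \<eta> i + \<zeta> i) =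
     duality_pairing n s w \<xi> \<eta> + duality_pairing n s w \<xi> \<zeta>"
  by (simp add: duality_pairing_def algebra_simps sum.distrib)

lemma duality_pairing_uminus:
  "duality_pairing n s w \<xi> (\<lambda>i. - \<eta> i) = - duality_pairing n s w \<xi> \<eta>"
  by (simp add: duality_pairing_def sum_negf)

context
  fixes n :: nat and s :: real and w :: "nat \<Rightarrow> real"
  assumes s: "1 < s" and w: "\<forall>i\<in>{1..n}. 0 < w i"
begin

lemma wnorm_powr: "wnorm n s w \<xi> powr s = (\<Sum>i=1..n. w i * \<bar>\<xi> i\<bar> powr s)"
proof -
  have "0 \<le> (\<Sum>i=1..n. w i * \<bar>\<xi> i\<bar> powr s)"
    using w by (intro sum_nonneg) (simp add: less_imp_le)
  then show ?thesis using s by (simp add: wnorm_def powr_powr)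
qed

lemma wnorm_eq_0_iff: "wnorm n s w \<xi> = 0 \<longleftrightarrow> (\<forall>i\<in>{1..n}. \<xi> i = 0)"
proof -
  have "wnorm n s w \<xi> = 0 \<longleftrightarrow> (\<Sum>i=1..n. w i * \<bar>\<xi> i\<bar> powr s) = 0"
    by (simp add: wnorm_def)
  also have "\<dots> \<longleftrightarrow> (\<forall>i\<in>{1..n}. w i * \<bar>\<xi> i\<bar> powr s = 0)"
    using w by (intro sum_nonneg_eq_0_iff) (auto simp: less_imp_le)
  also have "\<dots> \<longleftrightarrow> (\<forall>i\<in>{1..n}. \<xi> i = 0)"
    using w by fastforce
  finally show ?thesis .
qed

lemma duality_pairing_self: "duality_pairing n s w \<xi> \<xi> = wnorm n s w \<xi> powr s"
  unfolding duality_pairing_def wnorm_powr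
  by (intro sum.cong refl) (simp only: mult.assoc abs_powr_diff_2_mult_self[simplified mult.assoc])

text \<open>For \<open>p = s\<close> the distance decouples into coordinates. Nonnegative summands
  yield Hoelder; quantitative lower bounds on them yield the lower estimate for
  \<open>p = s\<close>.\<close>

lemma sum_power_bregman:
  "(\<Sum>i=1..n. w i * power_bregman s (\<zeta> i) (\<xi> i)) =
     wnorm n s w \<zeta> powr s + (s - 1) * wnorm n s w \<xi> powr s - s * duality_pairing n s w \<xi> \<zeta>"
  unfolding power_bregman_altdef duality_pairing_def wnorm_powr
  by (simp add: algebra_simps sum.distrib sum_subtractf sum_distrib_left)

lemma wnorm_scale: "wnorm n s w (\<lambda>i. k * \<xi> i) = \<bar>k\<bar> * wnorm n s w \<xi>"
proof -
  have "(\<Sum>i=1..n. w i * \<bar>k * \<xi> i\<bar> powr s) = \<bar>k\<bar> powr s * (\<Sum>i=1..n. w i * \<bar>\<xi> i\<bar> powr s)"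
    by (simp add: abs_mult powr_mult sum_distrib_left mult_ac)
  then show ?thesis using s by (simp add: wnorm_def powr_mult powr_powr)
qed

lemma duality_pairing_scale:
  assumes "0 \<le> k"
  shows "duality_pairing n s w (\<lambda>i. k * \<xi> i) (\<lambda>i. j * \<eta> i) =
    k powr (s - 1) * j * duality_pairing n s w \<xi> \<eta>"
proof -
  have "w i * \<bar>k * \<xi> i\<bar> powr (s - 2) * (k * \<xi> i) * (j * \<eta> i) =
      k powr (s - 1) * j * (w i * \<bar>\<xi> i\<bar> powr (s - 2) * \<xi> i * \<eta> i)" for i
    unfolding powr_diff_2_mult_nonneg[OF assms, of s, symmetric] abs_mult powr_mult
    using assms by simp
  then show ?thesis
    by (simp only: duality_pairing_def sum_distrib_left)
qed

text \<open>This is the Hoelder inequality: after normalising both norms to 1, sum the Young inequality,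
  which is the nonnegativity of \<open>power_bregman\<close>.\<close>

lemma duality_pairing_le:
  "duality_pairing n s w \<xi> \<eta> \<le> wnorm n s w \<xi> powr (s - 1) * wnorm n s w \<eta>"
proof (cases "wnorm n s w \<xi> = 0 \<or> wnorm n s w \<eta> = 0")
  case True
  then have "duality_pairing n s w \<xi> \<eta> = 0"
    unfolding wnorm_eq_0_iff duality_pairing_def by (intro sum.neutral) auto
  then show ?thesis by simp
next
  case False
  define A B where "A = wnorm n s w \<xi>" and "B = wnorm n s w \<eta>"
  have pos: "0 < A" "0 < B"
    using False wnorm_nonneg[of n s w] by (auto simp: A_def B_def order.strict_iff_order)
  have "0 \<le> (\<Sum>i=1..n. w i * power_bregman s (1 / B * \<eta> i) (1 / A * \<xi> i))"
    using w power_bregman_nonneg[OF s] by (intro sum_nonneg mult_nonneg_nonneg) (auto simp: less_imp_le)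
  also have "\<dots> = s * (1 - (1 / A) powr (s - 1) * (1 / B) * duality_pairing n s w \<xi> \<eta>)"
    unfolding sum_power_bregman wnorm_scale
    using pos by (subst duality_pairing_scale) (auto simp: A_def B_def algebra_simps)
  finally have "(1 / A) powr (s - 1) * (1 / B) * duality_pairing n s w \<xi> \<eta> \<le> 1"
    using s by (simp add: zero_le_mult_iff)
  then show ?thesis
    using pos by (simp add: powr_divide divide_simps A_def B_def mult_ac)
qed

text \<open>Pair the sum with itself, apply Hoelder to each of the two terms and cancel
  \<open>Z powr (s - 1)\<close>.\<close>

lemma wnorm_triangle: "wnorm n s w (\<lambda>i. \<xi> i + \<eta> i) \<le> wnorm n s w \<xi> + wnorm n s w \<eta>"
proof (cases "wnorm n s w (\<lambda>i. \<xi> i + \<eta> i) = 0")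
  case False
  define Z where "Z = wnorm n s w (\<lambda>i. \<xi> i + \<eta> i)"
  have Z: "0 < Z" using False wnorm_nonneg[of n s w] by (auto simp: Z_def order.strict_iff_order)
  have "Z powr (s - 1) * Z = Z powr s"
    using Z powr_add[of Z "s - 1" 1] by simp
  also have "\<dots> \<le> Z powr (s - 1) * (wnorm n s w \<xi> + wnorm n s w \<eta>)"
    using duality_pairing_le[of "\<lambda>i. \<xi> i + \<eta> i" \<xi>] duality_pairing_le[of "\<lambda>i. \<xi> i + \<eta> i" \<eta>]
    unfolding Z_def
    by (simp flip: duality_pairing_self add: duality_pairing_add distrib_left)
  finally show ?thesis using Z by (simp flip: Z_def)
qed simp

lemma bregman_add_eq:
  "bregman n s p w (Rn_add n \<xi> \<eta>) \<xi> =
     wnorm n s w (\<lambda>i. \<xi> i + \<eta> i) powr p - wnorm n s w \<xi> powr p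
     - p * wnorm n s w \<xi> powr (p - s) * duality_pairing n s w \<xi> \<eta>"
  by (simp add: bregman_def Rn_add_def duality_pairing_def wnorm_def)

text \<open>The radial part is a one-dimensional Bregman distance, the angular part is the defect in
  the Hoelder inequality.\<close>

lemma bregman_add_decomp:
  "bregman n s p w (Rn_add n \<xi> \<eta>) \<xi> =
     power_bregman p (wnorm n s w (\<lambda>i. \<xi> i + \<eta> i)) (wnorm n s w \<xi>)
     + p * wnorm n s w \<xi> powr (p - s) *
       (wnorm n s w \<xi> powr (s - 1) * wnorm n s w (\<lambda>i. \<xi> i + \<eta> i)
        - duality_pairing n s w \<xi> (\<lambda>i. \<xi> i + \<eta> i))"
proof -
  define A where "A = wnorm n s w \<xi>"
  \<comment> \<open>Both splittings remain true for \<open>A = 0\<close>, where every power is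
    0.\<close>
  have e: "A powr (p - 1) = A powr (p - s) * A powr (s - 1)"
    "A powr p = A powr (p - s) * A powr s"
    by (simp_all flip: powr_add)
  have "\<bar>A\<bar> powr (p - 2) * A = A powr (p - 1)" "\<bar>A\<bar> = A"
    by (simp_all add: A_def powr_diff_2_mult_nonneg)
  then show ?thesis
    unfolding bregman_add_eq power_bregman_altdef duality_pairing_add duality_pairing_self
      A_def[symmetric] by (simp add: e algebra_simps)
qed

end

section \<open>Lower bound, first for \<open>p = s\<close>, then for general
  \<open>p\<close>\<close>

text \<open>Only the coordinates with \<open>\<bar>\<xi>\<^sub>i\<bar> \<le> 2\<bar>\<eta>\<^sub>i\<bar>\<close> are used: the others contribute at most
  \<open>2\<^sup>-\<^sup>s |\<xi>|\<^sup>s\<close> to \<open>|\<eta>|\<^sup>s\<close>.\<close>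

lemma bregman_same_exponent_lower:
  fixes s :: real
  assumes s: "1 < s"
  obtains c where "0 < c"
    "\<And>n w \<xi> \<eta>. (\<forall>i\<in>{1..n}. 0 < w i) \<Longrightarrow> wnorm n s w \<xi> \<le> wnorm n s w \<eta> \<Longrightarrow>
      c * wnorm n s w \<eta> powr s \<le> wnorm n s w (\<lambda>i. \<xi> i + \<eta> i) powr s
        + (s - 1) * wnorm n s w \<xi> powr s - s * duality_pairing n s w \<xi> (\<lambda>i. \<xi> i + \<eta> i)"
proof -
  obtain c where c: "0 < c" "\<And>x h. \<bar>x\<bar> \<le> 2 * \<bar>h\<bar> \<Longrightarrow> c * \<bar>h\<bar> powr s \<le> power_bregman s (x + h) x"
    by (rule power_bregman_lower[OF s]) (rule that)
  define d where "d = (1 / 2) powr s"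
  have "d < 1" using s powr_less_mono2[of s "1/2" 1] by (simp add: d_def)
  have pointwise: "c * (\<bar>h\<bar> powr s - d * \<bar>x\<bar> powr s) \<le> power_bregman s (x + h) x" for x h
  proof (cases "\<bar>x\<bar> \<le> 2 * \<bar>h\<bar>")
    case True
    have "c * (\<bar>h\<bar> powr s - d * \<bar>x\<bar> powr s) \<le> c * \<bar>h\<bar> powr s"
      using c by (intro mult_left_mono) (auto simp: d_def)
    then show ?thesis using c(2)[OF True] by simp
  next
    case False
    then have "\<bar>h\<bar> powr s \<le> (1 / 2 * \<bar>x\<bar>) powr s"
      using s by (intro powr_mono2) auto
    also have "\<dots> = d * \<bar>x\<bar> powr s" unfolding d_def by (subst powr_mult) auto
    finally have "c * (\<bar>h\<bar> powr s - d * \<bar>x\<bar> powr s) \<le> 0"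
      using c by (simp add: mult_le_0_iff)
    then show ?thesis using power_bregman_nonneg[OF s] order_trans by blast
  qed
  show ?thesis
  proof (rule that)
    show "0 < c * (1 - d)" using c \<open>d < 1\<close> by simp
    fix n w \<xi> \<eta>
    assume w: "\<forall>i\<in>{1..n}. 0 < w i" and le: "wnorm n s w \<xi> \<le> wnorm n s w \<eta>"
    \<comment> \<open>The loss \<open>d * wnorm n s w \<xi> powr s\<close> is absorbed by comparing
      the norms; the fraction \<open>1 - d > 0\<close> remains.\<close>
    have "wnorm n s w \<xi> powr s \<le> wnorm n s w \<eta> powr s"
      using le s by (intro powr_mono2) auto
    then have "d * wnorm n s w \<xi> powr s \<le> d * wnorm n s w \<eta> powr s"
      by (intro mult_left_mono) (auto simp: d_def)
    then have "c * (1 - d) * wnorm n s w \<eta> powr s \<le>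
        c * (wnorm n s w \<eta> powr s - d * wnorm n s w \<xi> powr s)"
      using c by (simp add: algebra_simps)
    also have "\<dots> = (\<Sum>i=1..n. w i * (c * (\<bar>\<eta> i\<bar> powr s - d * \<bar>\<xi> i\<bar> powr s)))"
      unfolding wnorm_powr[OF s w]
      by (simp add: sum_distrib_left sum_subtractf algebra_simps)
    also have "\<dots> \<le> (\<Sum>i=1..n. w i * power_bregman s (\<xi> i + \<eta> i) (\<xi> i))"
      using w pointwise by (intro sum_mono mult_left_mono) (auto simp: less_imp_le)
    finally show "c * (1 - d) * wnorm n s w \<eta> powr s \<le> wnorm n s w (\<lambda>i. \<xi> i + \<eta> i) powr s
        + (s - 1) * wnorm n s w \<xi> powr s - s * duality_pairing n s w \<xi> (\<lambda>i. \<xi> i + \<eta> i)"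
      unfolding sum_power_bregman[OF s w] .
  qed
qed

lemma bregman_lower:
  fixes s p :: real
  assumes s: "1 < s" and p: "1 < p"
  obtains c where "0 < c"
    "\<And>n w \<xi> \<eta>. (\<forall>i\<in>{1..n}. 0 < w i) \<Longrightarrow> wnorm n s w \<xi> \<le> wnorm n s w \<eta> \<Longrightarrow>
      c * wnorm n s w \<eta> powr p \<le> bregman n s p w (Rn_add n \<xi> \<eta>) \<xi>"
proof -
  obtain cs where cs: "0 < cs"
    "\<And>n w \<xi> \<eta>. (\<forall>i\<in>{1..n}. 0 < w i) \<Longrightarrow> wnorm n s w \<xi> \<le> wnorm n s w \<eta> \<Longrightarrow>
      cs * wnorm n s w \<eta> powr s \<le> wnorm n s w (\<lambda>i. \<xi> i + \<eta> i) powr s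
        + (s - 1) * wnorm n s w \<xi> powr s - s * duality_pairing n s w \<xi> (\<lambda>i. \<xi> i + \<eta> i)"
    by (rule bregman_same_exponent_lower[OF s]) (rule that)
  \<comment> \<open>\<open>L\<close> is the constant of \<open>power_bregman_upper\<close> for
    \<open>R = 2 * B\<close>, with the power of \<open>B\<close> split off.\<close>
  define L where "L = s * 2 powr (s - 1)"
  have L: "0 < L" using s by (simp add: L_def)
  \<comment> \<open>The bound 1/2 will force \<open>A \<ge> B / 4\<close>; the other one lets the
    radial part for exponent \<open>s\<close> consume at most half of the lower bound
    \<open>cs\<close>.\<close>
  define \<epsilon> where "\<epsilon> = min (1 / 2) (cs / (2 * L))"
  have \<epsilon>: "0 < \<epsilon>" "\<epsilon> \<le> 1 / 2" "L * \<epsilon> \<le> cs / 2"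
    using cs(1) L by (auto simp: \<epsilon>_def min_def field_simps)
  obtain cp where cp: "0 < cp"
    "\<And>x h. \<bar>x\<bar> \<le> 1 / \<epsilon> * \<bar>h\<bar> \<Longrightarrow> cp * \<bar>h\<bar> powr p \<le> power_bregman p (x + h) x"
    by (rule power_bregman_lower[OF p]) (rule that)
  \<comment> \<open>For \<open>B / 4 \<le> A \<le> B\<close> this compares
    \<open>A powr (p - s)\<close> with \<open>B powr (p - s)\<close>, whatever the sign of
    \<open>p - s\<close>.\<close>
  define m where "m = min 1 ((1 / 4) powr (p - s))"
  have m: "0 < m" by (simp add: m_def)
  define c1 c2 where "c1 = cp * \<epsilon> powr p" and "c2 = p * m * cs / (2 * s)"
  have c12: "0 < c1" "0 < c2"
    using cp \<epsilon> m p s cs(1) by (auto simp: c1_def c2_def)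
  show ?thesis
  proof (rule that)
    show "0 < min c1 c2" using c12 by simp
    fix n w \<xi> \<eta>
    assume w: "\<forall>i\<in>{1..n}. 0 < w i" and le: "wnorm n s w \<xi> \<le> wnorm n s w \<eta>"
    define A B Z T where "A = wnorm n s w \<xi>" and "B = wnorm n s w \<eta>"
      and "Z = wnorm n s w (\<lambda>i. \<xi> i + \<eta> i)"
      and "T = duality_pairing n s w \<xi> (\<lambda>i. \<xi> i + \<eta> i)"
    have nonneg: "0 \<le> A" "0 \<le> B" "0 \<le> Z" by (simp_all add: A_def B_def Z_def)
    have AB: "A \<le> B" using le by (simp add: A_def B_def)
    have Z_le: "Z \<le> A + B"
      using wnorm_triangle[OF s w] by (simp add: A_def B_def Z_def)
    \<comment> \<open>Triangle inequality for \<eta> as the sum of -\<xi> and \<xi> +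
      \<eta>.\<close>
    have B_le: "B \<le> A + Z"
      using wnorm_triangle[OF s w, of "\<lambda>i. - \<xi> i" "\<lambda>i. \<xi> i + \<eta> i"]
      by (simp add: A_def B_def Z_def)
    have defect: "0 \<le> A powr (s - 1) * Z - T"
      using duality_pairing_le[OF s w] by (simp add: A_def Z_def T_def)
    have decomp: "bregman n s p w (Rn_add n \<xi> \<eta>) \<xi> =
        power_bregman p Z A + p * A powr (p - s) * (A powr (s - 1) * Z - T)"
      unfolding A_def Z_def T_def by (rule bregman_add_decomp[OF s w])
    show "min c1 c2 * wnorm n s w \<eta> powr p \<le> bregman n s p w (Rn_add n \<xi> \<eta>) \<xi>"
      unfolding B_def[symmetric]
    proof (cases "\<epsilon> * B \<le> \<bar>Z - A\<bar>")
      \<comment> \<open>Radial case: \<open>A \<le> B \<le> \<bar>Z - A\<bar> / \<epsilon>\<close>,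
        so the one-dimensional lower bound with \<open>K = 1 / \<epsilon>\<close> suffices.\<close>
      case True
      have "min c1 c2 * B powr p \<le> c1 * B powr p"
        by (intro mult_right_mono) auto
      also have "\<dots> = cp * (\<epsilon> * B) powr p"
        using \<epsilon> by (simp add: c1_def powr_mult)
      also have "\<dots> \<le> cp * \<bar>Z - A\<bar> powr p"
        using True cp(1) p \<epsilon>(1) nonneg by (intro mult_left_mono powr_mono2) auto
      also have "\<dots> \<le> power_bregman p Z A"
      proof -
        have "\<epsilon> * A \<le> \<epsilon> * B" using AB \<epsilon>(1) by simp
        then have "\<epsilon> * A \<le> \<bar>Z - A\<bar>" using True by linarith
        then have "\<bar>A\<bar> \<le> 1 / \<epsilon> * \<bar>Z - A\<bar>"
          using nonneg \<epsilon>(1) by (simp add: field_simps)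
        then show ?thesis using cp(2)[of A "Z - A"] by simp
      qed
      also have "\<dots> \<le> bregman n s p w (Rn_add n \<xi> \<eta>) \<xi>"
        unfolding decomp using defect p by simp
      finally show "min c1 c2 * B powr p \<le> bregman n s p w (Rn_add n \<xi> \<eta>) \<xi>" .
    next
      case False
      then have B: "0 < B" using nonneg by (cases "B = 0") auto
      have "\<epsilon> * B \<le> 1 / 2 * B" using \<epsilon> B by (intro mult_right_mono) auto
      \<comment> \<open>Now \<open>Z < A + B / 2\<close>, hence
        \<open>B \<le> A + Z < 2 * A + B / 2\<close>.\<close>
      then have A: "1 / 4 * B \<le> A" using False B_le by linarith
      have "power_bregman s Z A \<le> s * (2 * B) powr (s - 1) * \<bar>Z - A\<bar>"
        using AB Z_le nonneg by (intro power_bregman_upper[OF s]) auto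
      also have "\<dots> \<le> s * (2 * B) powr (s - 1) * (\<epsilon> * B)"
        using False s by (intro mult_left_mono) auto
      also have "\<dots> = L * \<epsilon> * B powr s"
        using B powr_add[of B "s - 1" 1] by (simp add: powr_mult L_def)
      also have "\<dots> \<le> cs / 2 * B powr s"
        using \<epsilon> by (intro mult_right_mono) auto
      finally have small: "power_bregman s Z A \<le> cs / 2 * B powr s" .
      \<comment> \<open>The Hoelder defect does not involve \<open>p\<close>. The estimate for
        exponent \<open>s\<close>, less its small radial part, therefore bounds it from below for
        every \<open>p\<close>.\<close>
      have "cs * B powr s \<le> Z powr s + (s - 1) * A powr s - s * T"
        using cs(2)[OF w le] by (simp add: A_def B_def Z_def T_def)
      also have "\<dots> = power_bregman s Z A + s * (A powr (s - 1) * Z - T)"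
        using nonneg by (simp add: power_bregman_altdef powr_diff_2_mult_nonneg right_diff_distrib)
      finally have gap: "cs / (2 * s) * B powr s \<le> A powr (s - 1) * Z - T"
        using small s by (simp add: field_simps)
      have "m * B powr (p - s) \<le> A powr (p - s)"
      proof (cases "s \<le> p")
        case True
        have "m * B powr (p - s) \<le> (1 / 4) powr (p - s) * B powr (p - s)"
          by (intro mult_right_mono) (auto simp: m_def)
        also have "\<dots> = (1 / 4 * B) powr (p - s)"
          by (subst powr_mult) auto
        also have "\<dots> \<le> A powr (p - s)"
          using A B True by (intro powr_mono2) auto
        finally show ?thesis .
      next
        case False
        have "m * B powr (p - s) \<le> 1 * B powr (p - s)"
          by (intro mult_right_mono) (auto simp: m_def)
        also have "\<dots> \<le> A powr (p - s)"
          using A B AB False by (auto intro!: powr_mono2')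
        finally show ?thesis .
      qed
      then have *: "p * (m * B powr (p - s)) * (cs / (2 * s) * B powr s) \<le>
          p * A powr (p - s) * (A powr (s - 1) * Z - T)"
        using gap p m cs(1) s by (intro mult_mono mult_left_mono) auto
      have "min c1 c2 * B powr p \<le> c2 * B powr p"
        by (intro mult_right_mono) auto
      also have "\<dots> = p * (m * B powr (p - s)) * (cs / (2 * s) * B powr s)"
        using powr_add[of B "p - s" s] by (simp add: c2_def)
      also note *
      also have "p * A powr (p - s) * (A powr (s - 1) * Z - T) \<le> bregman n s p w (Rn_add n \<xi> \<eta>) \<xi>"
        unfolding decomp using power_bregman_nonneg[OF p] by simp
      finally show "min c1 c2 * B powr p \<le> bregman n s p w (Rn_add n \<xi> \<eta>) \<xi>" .
    qed
  qed
qed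

section \<open>Upper bound\<close>

text \<open>The term \<open>2 powr p\<close> comes from \<open>Z \<le> A + B \<le> 2 * B\<close>,
  the term \<open>p\<close> from Hoelder applied to -\<eta>.\<close>

lemma bregman_upper:
  fixes s p :: real
  assumes s: "1 < s" and p: "1 < p" and w: "\<forall>i\<in>{1..n}. 0 < w i"
    and le: "wnorm n s w \<xi> \<le> wnorm n s w \<eta>"
  shows "bregman n s p w (Rn_add n \<xi> \<eta>) \<xi> \<le> (2 powr p + p) * wnorm n s w \<eta> powr p"
proof -
  define A B Z where "A = wnorm n s w \<xi>" and "B = wnorm n s w \<eta>"
    and "Z = wnorm n s w (\<lambda>i. \<xi> i + \<eta> i)"
  have nonneg: "0 \<le> A" "0 \<le> B" "0 \<le> Z" by (simp_all add: A_def B_def Z_def)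
  have AB: "A \<le> B" using le by (simp add: A_def B_def)
  have "Z \<le> A + B"
    using wnorm_triangle[OF s w] by (simp add: A_def B_def Z_def)
  then have "Z powr p \<le> (2 * B) powr p"
    using AB nonneg p by (intro powr_mono2) auto
  then have Z: "Z powr p \<le> 2 powr p * B powr p"
    using nonneg by (simp add: powr_mult)
  have "- duality_pairing n s w \<xi> \<eta> \<le> A powr (s - 1) * B"
    using duality_pairing_le[OF s w, of \<xi> "\<lambda>i. - \<eta> i"]
    by (simp add: duality_pairing_uminus A_def B_def)
  then have "A powr (p - s) * - duality_pairing n s w \<xi> \<eta> \<le> A powr (p - s) * (A powr (s - 1) * B)"
    by (intro mult_left_mono) auto
  \<comment> \<open>Since \<open>p - s\<close> may be negative, \<open>A \<le> B\<close> is used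
    only after merging the powers into one with exponent \<open>p - 1 > 0\<close>.\<close>
  also have "\<dots> = A powr (p - 1) * B"
    by (simp flip: powr_add mult.assoc)
  also have "\<dots> \<le> B powr (p - 1) * B"
    using AB nonneg p by (intro mult_right_mono powr_mono2) auto
  also have "\<dots> = B powr p"
    using powr_add[of B "p - 1" 1] nonneg by simp
  finally have "p * (A powr (p - s) * - duality_pairing n s w \<xi> \<eta>) \<le> p * B powr p"
    using p by (intro mult_left_mono) auto
  then have "Z powr p - A powr p - p * A powr (p - s) * duality_pairing n s w \<xi> \<eta>
      \<le> (2 powr p + p) * B powr p"
    using Z powr_ge_zero[of A p] unfolding distrib_right mult.assoc mult_minus_right by linarith
  then show ?thesis
    by (simp add: bregman_add_eq[OF s w] A_def B_def Z_def)
qed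

section \<open>Interpolated powers and conclusion\<close>

text \<open>The quotient \<open>u = (B + A) / B\<close> lies in [1, 2], so its powers with exponents
  of modulus at most \<open>q\<close> lie between \<open>2 powr (- q)\<close> and
  \<open>2 powr q\<close>.\<close>

lemma interpolated_powr_bounds:
  fixes A B l p q :: real
  assumes "0 \<le> A" "A \<le> B" "\<bar>p - l\<bar> \<le> q"
  shows "B powr l * (B + A) powr (p - l) \<le> 2 powr q * B powr p"
    and "B powr p \<le> 2 powr q * (B powr l * (B + A) powr (p - l))"
proof -
  have "B powr l * (B + A) powr (p - l) \<le> 2 powr q * B powr p \<and>
      B powr p \<le> 2 powr q * (B powr l * (B + A) powr (p - l))"
  proof (cases "B = 0")
    case False
    then have B: "0 < B" using assms by simp
    define u where "u = (B + A) / B"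
    have u: "1 \<le> u" "u \<le> 2" using B assms by (auto simp: u_def field_simps)
    have upow: "u powr e \<le> 2 powr q" if "\<bar>e\<bar> \<le> q" for e
    proof -
      have "u powr e \<le> u powr q" using u that by (intro powr_mono) auto
      also have "\<dots> \<le> 2 powr q" using u that by (intro powr_mono2) auto
      finally show ?thesis .
    qed
    have "B powr l * (B + A) powr (p - l) = B powr l * (B * u) powr (p - l)"
      using B by (simp add: u_def)
    also have "\<dots> = u powr (p - l) * B powr p"
      using B u powr_add[of B l "p - l"] by (simp add: powr_mult)
    finally have eq: "B powr l * (B + A) powr (p - l) = u powr (p - l) * B powr p" .
    have "1 = u powr (l - p) * u powr (p - l)"
      using u by (simp flip: powr_add)
    also have "\<dots> \<le> 2 powr q * u powr (p - l)"
      using upow[of "l - p"] assms by (intro mult_right_mono) auto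
    finally have "1 * B powr p \<le> 2 powr q * u powr (p - l) * B powr p"
      by (intro mult_right_mono) auto
    moreover have "u powr (p - l) * B powr p \<le> 2 powr q * B powr p"
      using upow[of "p - l"] assms by (intro mult_right_mono) auto
    ultimately show ?thesis unfolding eq by (simp add: mult.assoc)
  qed simp
  then show "B powr l * (B + A) powr (p - l) \<le> 2 powr q * B powr p"
    and "B powr p \<le> 2 powr q * (B powr l * (B + A) powr (p - l))" by auto
qed

theorem lemma3p14:
  fixes s p :: real
  assumes "1 < s" and "1 < p"
  shows "\<exists>c C :: real. 0 < c \<and> c \<le> C \<and>
    (\<forall>(n::nat) \<Omega> a. 2 \<le> n \<longrightarrow> is_domain n \<Omega> \<longrightarrow> weight_vector n \<Omega> a \<longrightarrow>
      (AE x in Rn_lebesgue n. x \<in> \<Omega> \<longrightarrow>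
        (\<forall>\<xi>\<in>Rn n. \<forall>\<eta>\<in>Rn n. \<forall>l\<in>{min s 2..max s 2}.
          (let w = (\<lambda>i. a i x); N = wnorm n s w in
            N \<xi> \<le> N \<eta> \<longrightarrow>
            c * (N \<eta> powr l * (N \<eta> + N \<xi>) powr (p - l)) \<le> bregman n s p w (Rn_add n \<xi> \<eta>) \<xi> \<and>
            bregman n s p w (Rn_add n \<xi> \<eta>) \<xi> \<le> C * (N \<eta> powr l * (N \<eta> + N \<xi>) powr (p - l))))))"
proof -
  obtain c0 where c0: "0 < c0"
    "\<And>n w \<xi> \<eta>. (\<forall>i\<in>{1..n}. 0 < w i) \<Longrightarrow> wnorm n s w \<xi> \<le> wnorm n s w \<eta> \<Longrightarrow>
      c0 * wnorm n s w \<eta> powr p \<le> bregman n s p w (Rn_add n \<xi> \<eta>) \<xi>"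
    by (rule bregman_lower[OF assms]) (rule that)
  define C0 where "C0 = 2 powr p + p"
  have C0: "0 < C0" using assms by (simp add: C0_def add_pos_pos)
  \<comment> \<open>This bounds \<open>\<bar>p - l\<bar>\<close> for all admissible
    \<open>l\<close>, so the constants are uniform in \<open>l\<close>.\<close>
  define q where "q = p + max s 2"
  \<comment> \<open>The maximum in \<open>C\<close> secures \<open>c \<le> C\<close>.\<close>
  define c C where "c = c0 / 2 powr q" and "C = max c (C0 * 2 powr q)"
  have c: "0 < c" using c0(1) by (simp add: c_def)
  have bounds: "c * (wnorm n s w \<eta> powr l * (wnorm n s w \<eta> + wnorm n s w \<xi>) powr (p - l))
        \<le> bregman n s p w (Rn_add n \<xi> \<eta>) \<xi> \<and>
      bregman n s p w (Rn_add n \<xi> \<eta>) \<xi>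
        \<le> C * (wnorm n s w \<eta> powr l * (wnorm n s w \<eta> + wnorm n s w \<xi>) powr (p - l))"
    if w: "\<forall>i\<in>{1..n}. 0 < w i" and le: "wnorm n s w \<xi> \<le> wnorm n s w \<eta>"
      and l: "l \<in> {min s 2..max s 2}" for n w \<xi> \<eta> l
  proof -
    define X where "X = wnorm n s w \<eta> powr l * (wnorm n s w \<eta> + wnorm n s w \<xi>) powr (p - l)"
    define Y where "Y = wnorm n s w \<eta> powr p"
    have "\<bar>p - l\<bar> \<le> q" using l assms by (auto simp: q_def)
    then have XY: "X \<le> 2 powr q * Y" "Y \<le> 2 powr q * X"
      unfolding X_def Y_def using le by (auto intro!: interpolated_powr_bounds)
    have "c * X \<le> c * (2 powr q * Y)" using XY c by simp
    also have "\<dots> = c0 * Y" by (simp add: c_def)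
    also have "\<dots> \<le> bregman n s p w (Rn_add n \<xi> \<eta>) \<xi>"
      unfolding Y_def by (rule c0(2)[OF w le])
    finally have lower: "c * X \<le> bregman n s p w (Rn_add n \<xi> \<eta>) \<xi>" .
    have "bregman n s p w (Rn_add n \<xi> \<eta>) \<xi> \<le> C0 * Y"
      unfolding Y_def C0_def by (rule bregman_upper[OF assms w le])
    also have "\<dots> \<le> C0 * (2 powr q * X)" using XY C0 by simp
    also have "\<dots> \<le> C * X"
      unfolding mult.assoc[symmetric] by (intro mult_right_mono) (auto simp: C_def X_def)
    finally show ?thesis using lower by (simp add: X_def)
  qed
  show ?thesis
  \<comment> \<open>Fixing a point of the domain turns the weights into positive numbers, to which
    \<open>bounds\<close> applies.\<close>
  proof (rule exI[of _ c], rule exI[of _ C], intro conjI allI impI AE_I2 ballI)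
    fix n :: nat and \<Omega> a x \<xi> \<eta> and l :: real
    assume "weight_vector n \<Omega> a" "x \<in> \<Omega>"
    then have "\<forall>i\<in>{1..n}. 0 < a i x" by (simp add: weight_vector_def)
    moreover assume "l \<in> {min s 2..max s 2}"
    ultimately show "let w = (\<lambda>i. a i x); N = wnorm n s w in
            N \<xi> \<le> N \<eta> \<longrightarrow>
            c * (N \<eta> powr l * (N \<eta> + N \<xi>) powr (p - l)) \<le> bregman n s p w (Rn_add n \<xi> \<eta>) \<xi> \<and>
            bregman n s p w (Rn_add n \<xi> \<eta>) \<xi> \<le> C * (N \<eta> powr l * (N \<eta> + N \<xi>) powr (p - l))"
      unfolding Let_def by (intro impI bounds)
  qed (use c in \<open>auto simp: C_def\<close>)
qed

end
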